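(* Let $(S,\mathcal{F})$ be a measurable space and let $\mathcal{P}$ be the set of all probability measures on $(S,\mathcal{F})$. Let $\beta,\gamma\in\mathbb{R}\setminus\{0\}$ with $\beta<\gamma$, and let $\nu\in\mathcal{P}$. Then for every bounded and measurable $g:S\to\mathbb{R}$ the following hold. (1) $$\frac{1}{\beta}\log\int_S e^{\beta g}\,d\nu=\inf_{\theta\in\mathcal{P}}\Big[\frac{1}{\gamma}\log\int_S e^{\gamma g}\,d\theta+\frac{1}{\gamma-\beta}R_{\frac{\gamma}{\gamma-\beta}}(\nu\Vert\theta)\Big],$$ and the infimum is uniquely attained at the probability measure $\theta$ given by $d\theta=\frac{1}{Z}e^{-(\gamma-\beta)g}\,d\nu$, where $Z=\int_S e^{-(\gamma-\beta)g}\,d\nu$. (2) $$\frac{1}{\gamma}\log\int_S e^{\gamma g}\,d\nu=\sup_{\theta\in\mathcal{P}}\Big[\frac{1}{\beta}\log\int_S e^{\beta g}\,d\theta-\frac{1}{\gamma-\beta}R_{\frac{\gamma}{\gamma-\beta}}(\theta\Vert\nu)\Big],$$ and the supremum is uniquely attained at the probability measure $\theta$ given by $d\theta=\frac{1}{Z}e^{(\gamma-\beta)g}\,d\nu$, where $Z=\int_S e^{(\gamma-\beta)g}\,d\nu$. Here $R_\alpha$ denotes the Rényi divergence of order $\alpha\in\mathbb{R}\setminus\{0,1\}$, with the normalization $\frac{1}{\alpha(\alpha-1)}$.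
   Context: Rényi divergence. For $\nu,\theta\in\mathcal{P}$, let $\mu$ be any $\sigma$-finite measure on $(S,\mathcal{F})$ dominating both (i.e. $\nu\ll\mu$ and $\theta\ll\mu$; for instance $\mu=\nu+\theta$), and write $\nu'=\frac{d\nu}{d\mu}$, $\theta'=\frac{d\theta}{d\mu}$. For $\alpha>0$, $\alpha\neq1$, define $$R_\alpha(\nu\Vert\theta)=\begin{cases}\infty & \text{if }\alpha>1\text{ and }\nu\not\ll\theta,\\ \displaystyle\frac{1}{\alpha(\alpha-1)}\log\int_{\{\nu'\theta'>0\}}\Big(\frac{\nu'}{\theta'}\Big)^{\alpha}d\theta & \text{otherwise.}\end{cases}$$ The value does not depend on the choice of $\mu$ and lies in $[0,\infty]$ (with $\log 0=-\infty$, $\log\infty=\infty$; in particular $R_\alpha(\nu\Vert\theta)=\infty$ if $\nu,\theta$ are mutually singular). For $\alpha<0$, define $R_\alpha(\nu\Vert\theta)=R_{1-\alpha}(\theta\Vert\nu)$. Note that $\frac{\gamma}{\gamma-\beta}\notin\{0,1\}$ when $\beta,\gamma\neq0$, $\beta<\gamma$. *)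

theory Defs
  imports "HOL-Probability.Probability"
begin

text \<open>
  The measurable space \<open>(S, \<F>)\<close> is carried by an arbitrary measure \<open>M\<close>, of which only
  \<open>space M\<close> and \<open>sets M\<close> matter; the set of probability measures on it is
  \<^term>\<open>space (prob_algebra M)\<close>.
\<close>

definition ln_ennreal :: "ennreal \<Rightarrow> ereal" where
  "ln_ennreal x = (if x = 0 then - \<infinity> else if x = \<infinity> then \<infinity> else ereal (ln (enn2real x)))"

definition measure_add :: "'a measure \<Rightarrow> 'a measure \<Rightarrow> 'a measure" where
  "measure_add \<nu> \<theta> = measure_of (space \<nu>) (sets \<nu>) (\<lambda>A. emeasure \<nu> A + emeasure \<theta> A)"

text \<open>
  Renyi divergence of order \<open>\<alpha> > 0\<close>, \<open>\<alpha> \<noteq> 1\<close>, computed with densities with respect to \<open>\<mu>\<close>.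
  \<^term>\<open>absolutely_continuous \<theta> \<nu>\<close> is \<open>\<nu> \<lless> \<theta>\<close>. The densities are finite almost everywhere,
  so \<^const>\<open>enn2real\<close> loses nothing under the integral.
\<close>

definition renyi_wrt :: "'a measure \<Rightarrow> real \<Rightarrow> 'a measure \<Rightarrow> 'a measure \<Rightarrow> ereal" where
  "renyi_wrt \<mu> \<alpha> \<nu> \<theta> =
    (if \<alpha> > 1 \<and> \<not> absolutely_continuous \<theta> \<nu> then \<infinity>
     else ereal (1 / (\<alpha> * (\<alpha> - 1))) *
       ln_ennreal (\<integral>\<^sup>+x\<in>{x \<in> space \<theta>. RN_deriv \<mu> \<nu> x * RN_deriv \<mu> \<theta> x > 0}.
         ennreal ((enn2real (RN_deriv \<mu> \<nu> x) / enn2real (RN_deriv \<mu> \<theta> x)) powr \<alpha>) \<partial>\<theta>))"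

text \<open>
  The dominating measure is fixed to be \<open>\<nu> + \<theta>\<close>; \<open>renyi_wrt_eq_renyi\<close> below shows that any other
  sigma-finite dominating measure gives the same value. The definition is meaningful for
  \<open>\<alpha> \<notin> {0, 1}\<close> only.
\<close>

definition renyi :: "real \<Rightarrow> 'a measure \<Rightarrow> 'a measure \<Rightarrow> ereal" where
  "renyi \<alpha> \<nu> \<theta> =
    (if \<alpha> < 0 then renyi_wrt (measure_add \<theta> \<nu>) (1 - \<alpha>) \<theta> \<nu>
     else renyi_wrt (measure_add \<nu> \<theta>) \<alpha> \<nu> \<theta>)"

lemma space_measure_add [simp]: "space (measure_add \<nu> \<theta>) = space \<nu>"
  by (simp add: measure_add_def)

lemma sets_measure_add [simp, measurable_cong]: "sets (measure_add \<nu> \<theta>) = sets \<nu>"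
  by (simp add: measure_add_def)

lemma emeasure_measure_add:
  assumes "sets \<nu> = sets \<theta>" "A \<in> sets \<nu>"
  shows "emeasure (measure_add \<nu> \<theta>) A = emeasure \<nu> A + emeasure \<theta> A"
proof (rule emeasure_measure_of[OF measure_add_def])
  show "sets \<nu> \<subseteq> Pow (space \<nu>)" by (rule sets.space_closed)
  show "positive (sets (measure_add \<nu> \<theta>)) (\<lambda>A. emeasure \<nu> A + emeasure \<theta> A)"
    by (simp add: positive_def)
  show "countably_additive (sets (measure_add \<nu> \<theta>)) (\<lambda>A. emeasure \<nu> A + emeasure \<theta> A)"
    using assms(1)
    by (auto simp: countably_additive_def suminf_add[symmetric] suminf_emeasure)
  show "A \<in> sets (measure_add \<nu> \<theta>)" using assms by simp
qed

lemma absolutely_continuous_measure_add: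
  assumes "sets \<nu> = sets \<theta>"
  shows "absolutely_continuous (measure_add \<nu> \<theta>) \<nu>" "absolutely_continuous (measure_add \<nu> \<theta>) \<theta>"
  using assms by (auto simp: absolutely_continuous_def null_sets_def emeasure_measure_add)

lemma finite_measure_measure_add:
  assumes "sets \<nu> = sets \<theta>" "finite_measure \<nu>" "finite_measure \<theta>"
  shows "finite_measure (measure_add \<nu> \<theta>)"
proof
  have "space \<theta> = space \<nu>" using assms(1) by (metis sets_eq_imp_space_eq)
  then show "emeasure (measure_add \<nu> \<theta>) (space (measure_add \<nu> \<theta>)) \<noteq> \<infinity>"
    using assms finite_measure.emeasure_finite[OF assms(2)] finite_measure.emeasure_finite[OF assms(3)]
    using emeasure_measure_add[OF assms(1), of "space \<nu>"] sets.top[of \<nu>] by (simp add: ennreal_add_eq_top)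
qed

lemma renyi_wrt_eq_measure_add:
  assumes s: "sets \<nu> = sets \<mu>" "sets \<theta> = sets \<mu>"
    and fin: "finite_measure \<nu>" "finite_measure \<theta>" and "sigma_finite_measure \<mu>"
    and ac: "absolutely_continuous \<mu> \<nu>" "absolutely_continuous \<mu> \<theta>"
  shows "renyi_wrt \<mu> \<alpha> \<nu> \<theta> = renyi_wrt (measure_add \<nu> \<theta>) \<alpha> \<nu> \<theta>"
proof -
  interpret \<mu>: sigma_finite_measure \<mu> by fact
  let ?\<tau> = "measure_add \<nu> \<theta>"
  have s\<nu>\<theta>: "sets \<nu> = sets \<theta>" and st: "sets ?\<tau> = sets \<mu>" using s by auto
  interpret \<tau>: finite_measure ?\<tau> by (rule finite_measure_measure_add[OF s\<nu>\<theta> fin])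
  have act: "absolutely_continuous \<mu> ?\<tau>"
    using ac s s\<nu>\<theta> by (auto simp: absolutely_continuous_def null_sets_def emeasure_measure_add subset_iff)
  define f where "f = RN_deriv \<mu> ?\<tau>"
  have fm[measurable]: "f \<in> borel_measurable \<mu>" by (simp add: f_def)
  have df: "density \<mu> f = ?\<tau>" unfolding f_def by (rule \<mu>.density_RN_deriv[OF act st])
  have ff: "AE x in \<mu>. f x \<noteq> \<infinity>"
    unfolding f_def by (rule \<mu>.RN_deriv_finite[OF _ act st]) unfold_locales
  have chain: "AE x in \<mu>. f x * RN_deriv ?\<tau> \<kappa> x = RN_deriv \<mu> \<kappa> x"
    if "sets \<kappa> = sets \<mu>" "absolutely_continuous ?\<tau> \<kappa>" for \<kappa>
  proof (rule \<mu>.RN_deriv_unique)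
    have [measurable]: "RN_deriv ?\<tau> \<kappa> \<in> borel_measurable \<mu>"
      using borel_measurable_RN_deriv[of ?\<tau> \<kappa>] measurable_cong_sets[OF st refl] by blast
    show "(\<lambda>x. f x * RN_deriv ?\<tau> \<kappa> x) \<in> borel_measurable \<mu>" by measurable
    have "density \<mu> (\<lambda>x. f x * RN_deriv ?\<tau> \<kappa> x) = density (density \<mu> f) (RN_deriv ?\<tau> \<kappa>)"
      by (rule density_density_eq[symmetric]) simp_all
    also have "\<dots> = \<kappa>"
      unfolding df using that st by (intro \<tau>.density_RN_deriv) simp_all
    finally show "density \<mu> (\<lambda>x. f x * RN_deriv ?\<tau> \<kappa> x) = \<kappa>" .
  qed
  have AE_\<theta>: "AE x in \<theta>. P x" if "AE x in \<mu>. P x" for P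
    using absolutely_continuous_AE[OF s(2) ac(2)] that by auto
  have d\<theta>: "density \<mu> (RN_deriv \<mu> \<theta>) = \<theta>" by (rule \<mu>.density_RN_deriv[OF ac(2) s(2)])
  have pos: "AE x in \<theta>. RN_deriv \<mu> \<theta> x > 0"
    by (subst d\<theta>[symmetric]) (simp add: AE_density)
  note AEs = AE_\<theta>[OF chain[OF s(1) absolutely_continuous_measure_add(1)[OF s\<nu>\<theta>]]]
    AE_\<theta>[OF chain[OF s(2) absolutely_continuous_measure_add(2)[OF s\<nu>\<theta>]]] AE_\<theta>[OF ff] pos
  have "(\<integral>\<^sup>+x\<in>{x \<in> space \<theta>. RN_deriv \<mu> \<nu> x * RN_deriv \<mu> \<theta> x > 0}.
         ennreal ((enn2real (RN_deriv \<mu> \<nu> x) / enn2real (RN_deriv \<mu> \<theta> x)) powr \<alpha>) \<partial>\<theta>)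
    = (\<integral>\<^sup>+x\<in>{x \<in> space \<theta>. RN_deriv ?\<tau> \<nu> x * RN_deriv ?\<tau> \<theta> x > 0}.
         ennreal ((enn2real (RN_deriv ?\<tau> \<nu> x) / enn2real (RN_deriv ?\<tau> \<theta> x)) powr \<alpha>) \<partial>\<theta>)"
  proof (rule nn_integral_cong_AE)
    show "AE x in \<theta>. ennreal ((enn2real (RN_deriv \<mu> \<nu> x) / enn2real (RN_deriv \<mu> \<theta> x)) powr \<alpha>) *
         indicator {x \<in> space \<theta>. RN_deriv \<mu> \<nu> x * RN_deriv \<mu> \<theta> x > 0} x
       = ennreal ((enn2real (RN_deriv ?\<tau> \<nu> x) / enn2real (RN_deriv ?\<tau> \<theta> x)) powr \<alpha>) *
         indicator {x \<in> space \<theta>. RN_deriv ?\<tau> \<nu> x * RN_deriv ?\<tau> \<theta> x > 0} x"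
      using AEs
    proof eventually_elim
      case (elim x)
      let ?n = "RN_deriv ?\<tau> \<nu> x" and ?t = "RN_deriv ?\<tau> \<theta> x"
      have f0: "f x \<noteq> 0" using elim(2,4) by auto
      then have r: "enn2real (f x) \<noteq> 0" using elim(3)
        by (auto simp: enn2real_eq_0_iff)
      have "enn2real (f x * ?n) / enn2real (f x * ?t) = enn2real ?n / enn2real ?t"
        using r by (simp add: enn2real_mult)
      moreover have "0 < (f x * ?n) * (f x * ?t) \<longleftrightarrow> 0 < ?n * ?t"
        using f0 by (auto simp: zero_less_iff_neq_zero)
      ultimately show ?case
        by (simp only: indicator_def mem_Collect_eq elim(1,2)[symmetric])
    qed
  qed
  then show ?thesis unfolding renyi_wrt_def by simp
qed

lemma renyi_wrt_eq_renyi: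
  assumes "sets \<nu> = sets \<mu>" "sets \<theta> = sets \<mu>" "prob_space \<nu>" "prob_space \<theta>"
    and "sigma_finite_measure \<mu>" "absolutely_continuous \<mu> \<nu>" "absolutely_continuous \<mu> \<theta>"
  shows "\<alpha> > 0 \<Longrightarrow> renyi \<alpha> \<nu> \<theta> = renyi_wrt \<mu> \<alpha> \<nu> \<theta>"
    and "\<alpha> < 0 \<Longrightarrow> renyi \<alpha> \<nu> \<theta> = renyi_wrt \<mu> (1 - \<alpha>) \<theta> \<nu>"
  using assms renyi_wrt_eq_measure_add[of \<nu> \<mu> \<theta>] renyi_wrt_eq_measure_add[of \<theta> \<mu> \<nu>]
  by (simp_all add: renyi_def prob_space_def)

end

theory Submission
  imports Defs
begin

text \<open>
  Write \<open>\<alpha> = \<gamma> / (\<gamma> - \<beta>)\<close> and tilt the measures, \<open>dP \<propto> e\<^sup>\<beta>\<^sup>g d\<nu>\<close> and \<open>dQ \<propto> e\<^sup>\<gamma>\<^sup>g d\<theta>\<close>. Since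
  \<open>\<alpha> \<beta> + (1 - \<alpha>) \<gamma> = 0\<close>, the exponential factors cancel in \<open>R\<^sub>\<alpha>(P \<parallel> Q)\<close> up to the normalizing
  constants, so that the functional in (1) equals
  \<open>(1 / \<beta>) log \<integral> e\<^sup>\<beta>\<^sup>g d\<nu> + R\<^sub>\<alpha>(P \<parallel> Q) / (\<gamma> - \<beta>)\<close>. It is therefore minimal exactly when \<open>P = Q\<close>,
  that is, when \<open>d\<theta> \<propto> e\<^sup>-\<^sup>(\<^sup>\<gamma>\<^sup>-\<^sup>\<beta>\<^sup>)\<^sup>g d\<nu>\<close>. Part (2) is part (1) for \<open>(-g, -\<gamma>, -\<beta>)\<close>, by the symmetry
  \<open>R\<^sub>1\<^sub>-\<^sub>\<alpha>(\<nu> \<parallel> \<theta>) = R\<^sub>\<alpha>(\<theta> \<parallel> \<nu>)\<close>.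
\<close>

section \<open>Strict weighted mean inequalities for real powers\<close>

text \<open>Strict concavity of \<open>ln\<close>: for \<open>s = a * r + (1 - a)\<close>, the
  points \<open>r / s\<close> and \<open>1 / s\<close> with weights \<open>a\<close> and
  \<open>1 - a\<close> have mean 1, so the tangent bound \<open>ln x \<le> x - 1\<close> makes the
  weighted mean of their logarithms negative.\<close>

lemma powr_less_affine:
  fixes a r :: real
  assumes "0 < a" "a < 1" "0 \<le> r" "r \<noteq> 1"
  shows "r powr a < a * r + (1 - a)"
proof (cases "r = 0")
  case False
  define s where "s = a * r + (1 - a)"
  have r: "r > 0" using False assms by simp
  have s: "s > 0" using assms r by (simp add: s_def add_pos_pos)
  \<comment> \<open>Strictness starts here: \<open>ln x = x - 1\<close> only at
    \<open>x = 1\<close>, and \<open>1 / s\<close> is not 1.\<close>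
  have "s \<noteq> 1" using assms by (simp add: s_def algebra_simps)
  then have "ln (1 / s) < 1 / s - 1" using s ln_eq_minus_one[of "1 / s"] ln_le_minus_one[of "1 / s"]
    by (force simp: less_le)
  then have "(1 - a) * ln (1 / s) < (1 - a) * (1 / s - 1)" using assms by simp
  moreover have "a * ln (r / s) \<le> a * (r / s - 1)"
    using assms r s by (intro mult_left_mono ln_le_minus_one) auto
  ultimately have "a * ln (r / s) + (1 - a) * ln (1 / s) < a * (r / s - 1) + (1 - a) * (1 / s - 1)"
    by linarith
  also have "\<dots> = 0" using s by (simp add: field_simps) (simp add: s_def algebra_simps)
  finally have "a * ln r < ln s" using r s by (simp add: ln_div algebra_simps)
  then have "exp (a * ln r) < s" using s by (metis exp_less_cancel_iff exp_ln)
  then show ?thesis using r by (simp add: powr_def s_def)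
qed (use assms in simp)

text \<open>The homogeneous form of the previous bound: apply it to \<open>n / t\<close> and
  multiply by \<open>t\<close>. For \<open>t = 0\<close> the left side is 0 and the right side is
  \<open>a * n > 0\<close>.\<close>

lemma powr_mult_powr_less:
  fixes a n t :: real
  assumes "0 < a" "a < 1" "0 \<le> n" "0 \<le> t" "n \<noteq> t"
  shows "n powr a * t powr (1 - a) < a * n + (1 - a) * t"
proof (cases "t = 0")
  case False
  then have t: "t > 0" using assms by simp
  have "(n / t) powr a * t < (a * (n / t) + (1 - a)) * t"
    using powr_less_affine[of a "n / t"] assms t by (intro mult_strict_right_mono) auto
  moreover have "(n / t) powr a * t = n powr a * t powr (1 - a)"
    using assms t by (simp add: powr_divide powr_diff)
  moreover have "(a * (n / t) + (1 - a)) * t = a * n + (1 - a) * t"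
    using t by (simp add: field_simps)
  ultimately show ?thesis by simp
qed (use assms in simp)

text \<open>For \<open>a > 1\<close> the inequality reverses. It is the previous one for the
  exponent \<open>1 / a\<close>, applied to \<open>n powr a * t powr (1 - a)\<close> and
  \<open>t\<close>, whose weighted geometric mean is \<open>n\<close>. At \<open>t = 0\<close> it
  would fail, since \<open>0 powr (1 - a) = 0\<close>.\<close>

lemma powr_mult_powr_greater:
  fixes a n t :: real
  assumes "1 < a" "0 \<le> n" "0 < t" "n \<noteq> t"
  shows "a * n + (1 - a) * t < n powr a * t powr (1 - a)"
proof -
  let ?m = "n powr a * t powr (1 - a)"
  have eq: "?m powr (1 / a) * t powr (1 - 1 / a) = n"
  proof -
    have "?m powr (1 / a) = n * t powr ((1 - a) / a)"
      using assms by (simp add: powr_mult powr_powr)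
    moreover have "t powr ((1 - a) / a) * t powr (1 - 1 / a) = 1"
      using assms by (simp add: powr_add[symmetric] diff_divide_distrib)
    ultimately show ?thesis by (simp add: mult.assoc)
  qed
  have "?m \<noteq> t"
  proof
    assume "?m = t"
    then have "t = n" using eq assms by (simp add: powr_add[symmetric])
    then show False using assms by simp
  qed
  then have "n < (1 / a) * ?m + (1 - 1 / a) * t"
    using powr_mult_powr_less[of "1 / a" ?m t] eq assms by simp
  then have "a * n < a * ((1 / a) * ?m + (1 - 1 / a) * t)" using assms by simp
  also have "\<dots> = ?m + (a - 1) * t" using assms by (simp add: field_simps)
  finally show ?thesis by (simp add: algebra_simps)
qed

text \<open>The equality case of both inequalities; \<open>n = 0\<close> fits because
  \<open>0 powr b = 0\<close> for every \<open>b\<close>.\<close>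

lemma powr_mult_powr_self:
  fixes a n :: real
  assumes "0 \<le> n"
  shows "n powr a * n powr (1 - a) = n"
  using assms by (cases "n = 0") (simp_all add: powr_add[symmetric])

section \<open>The extended logarithm, and the divergence in terms of densities\<close>

lemma emeasure_density_space:
  "f \<in> borel_measurable N \<Longrightarrow> emeasure (density N f) (space N) = (\<integral>\<^sup>+x. f x \<partial>N)"
  by (subst emeasure_density) (auto intro!: nn_integral_cong)

lemma ln_ennreal_less_0_iff: "ln_ennreal x < 0 \<longleftrightarrow> x < 1"
  by (cases x) (auto simp: ln_ennreal_def ennreal_less_iff simp flip: ennreal_1)

lemma ln_ennreal_eq_0_iff: "ln_ennreal x = 0 \<longleftrightarrow> x = 1"
  by (cases x) (auto simp: ln_ennreal_def simp flip: ennreal_1)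

lemma ln_ennreal_mult:
  assumes "0 < c"
  shows "ln_ennreal (ennreal c * x) = ereal (ln c) + ln_ennreal x"
proof (cases x)
  case (real r)
  then show ?thesis using assms
    by (cases "r = 0") (auto simp: ln_ennreal_def ln_mult simp flip: ennreal_mult)
qed (use assms in \<open>auto simp: ln_ennreal_def ennreal_mult_top\<close>)

text \<open>
  The restriction to \<open>{\<nu>'\<theta>' > 0}\<close> disappears because \<open>0 powr b = 0\<close> for every \<open>b\<close>, negative ones
  included.
\<close>

lemma renyi_wrt_density:
  fixes n t :: "'a \<Rightarrow> real"
  assumes "sigma_finite_measure \<mu>"
    and [measurable]: "n \<in> borel_measurable \<mu>" "t \<in> borel_measurable \<mu>"
    and nonneg: "\<And>x. 0 \<le> n x" "\<And>x. 0 \<le> t x"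
  shows "renyi_wrt \<mu> a (density \<mu> n) (density \<mu> t) =
    (if a > 1 \<and> \<not> absolutely_continuous (density \<mu> t) (density \<mu> n) then \<infinity>
     else ereal (1 / (a * (a - 1))) *
       ln_ennreal (\<integral>\<^sup>+x. ennreal (n x powr a * t x powr (1 - a)) \<partial>\<mu>))"
proof -
  interpret sigma_finite_measure \<mu> by fact
  let ?N = "RN_deriv \<mu> (density \<mu> n)" and ?T = "RN_deriv \<mu> (density \<mu> t)"
  have n: "AE x in \<mu>. ennreal (n x) = ?N x" by (rule RN_deriv_unique) auto
  have t: "AE x in \<mu>. ennreal (t x) = ?T x" by (rule RN_deriv_unique) auto
  have "(\<integral>\<^sup>+x\<in>{x \<in> space (density \<mu> t). ?N x * ?T x > 0}.
         ennreal ((enn2real (?N x) / enn2real (?T x)) powr a) \<partial>density \<mu> t)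
      = (\<integral>\<^sup>+x. ennreal (t x) * (ennreal ((enn2real (?N x) / enn2real (?T x)) powr a) *
          indicator {x \<in> space \<mu>. ?N x * ?T x > 0} x) \<partial>\<mu>)"
    by (subst nn_integral_density) auto
  also have "\<dots> = (\<integral>\<^sup>+x. ennreal (n x powr a * t x powr (1 - a)) \<partial>\<mu>)"
  proof (rule nn_integral_cong_AE)
    show "AE x in \<mu>. ennreal (t x) * (ennreal ((enn2real (?N x) / enn2real (?T x)) powr a) *
          indicator {x \<in> space \<mu>. ?N x * ?T x > 0} x) = ennreal (n x powr a * t x powr (1 - a))"
      using n t AE_space
    proof eventually_elim
      case (elim x)
      have "t x * (n x / t x) powr a = n x powr a * t x powr (1 - a)"
        if "t x > 0" using that nonneg[of x] by (simp add: powr_divide powr_diff)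
      then show ?case
        using nonneg[of x] elim(3)
        by (cases "n x = 0 \<or> t x = 0")
          (auto simp: elim(1,2)[symmetric] less_le simp flip: ennreal_mult)
    qed
  qed
  finally show ?thesis unfolding renyi_wrt_def by simp
qed

text \<open>Provides densities that are real-valued and nonnegative everywhere, so that real powers
  and pointwise inequalities apply; the dominating measure is the sum of the two.\<close>

lemma prob_algebra_common_density:
  assumes "\<nu> \<in> space (prob_algebra M)" "\<theta> \<in> space (prob_algebra M)"
  obtains \<mu> and n t :: "'a \<Rightarrow> real" where "sigma_finite_measure \<mu>" "sets \<mu> = sets M"
    "n \<in> borel_measurable \<mu>" "t \<in> borel_measurable \<mu>" "\<And>x. 0 \<le> n x" "\<And>x. 0 \<le> t x"
    "\<nu> = density \<mu> n" "\<theta> = density \<mu> t"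
proof -
  have s: "sets \<nu> = sets M" "sets \<theta> = sets M" and "prob_space \<nu>" "prob_space \<theta>"
    using assms by (auto simp: space_prob_algebra)
  define \<mu> where "\<mu> = measure_add \<nu> \<theta>"
  interpret finite_measure \<mu>
    unfolding \<mu>_def using s \<open>prob_space \<nu>\<close> \<open>prob_space \<theta>\<close>
    by (intro finite_measure_measure_add) (auto simp: prob_space_def)
  have sm: "sets \<mu> = sets M" using s by (simp add: \<mu>_def)
  have dens: "density \<mu> (\<lambda>x. ennreal (enn2real (RN_deriv \<mu> \<kappa> x))) = \<kappa>"
    if "sets \<kappa> = sets M" "absolutely_continuous \<mu> \<kappa>" "prob_space \<kappa>" for \<kappa>
  proof -
    have "sigma_finite_measure \<kappa>"
      using that(3) prob_space_imp_sigma_finite by blast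
    \<comment> \<open>Finiteness almost everywhere makes the passage through \<open>enn2real\<close>
      harmless.\<close>
    then have "AE x in \<mu>. RN_deriv \<mu> \<kappa> x \<noteq> \<infinity>"
      using that sm by (intro RN_deriv_finite) auto
    then have "density \<mu> (\<lambda>x. ennreal (enn2real (RN_deriv \<mu> \<kappa> x))) = density \<mu> (RN_deriv \<mu> \<kappa>)"
      by (intro density_cong) (auto elim!: eventually_mono simp: less_top)
    then show ?thesis using density_RN_deriv[of \<kappa>] that sm by simp
  qed
  have ac: "absolutely_continuous \<mu> \<nu>" "absolutely_continuous \<mu> \<theta>"
    unfolding \<mu>_def using s by (auto intro!: absolutely_continuous_measure_add)
  show ?thesis
    by (rule that[of \<mu> "\<lambda>x. enn2real (RN_deriv \<mu> \<nu> x)" "\<lambda>x. enn2real (RN_deriv \<mu> \<theta> x)"])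
      (use s sm ac \<open>prob_space \<nu>\<close> \<open>prob_space \<theta>\<close> in
        \<open>auto simp: dens sigma_finite_measure_axioms\<close>)
qed

lemma renyi_density:
  fixes n t :: "'a \<Rightarrow> real"
  assumes "sigma_finite_measure \<mu>" "n \<in> borel_measurable \<mu>" "t \<in> borel_measurable \<mu>"
    and "\<And>x. 0 \<le> n x" "\<And>x. 0 \<le> t x"
    and "prob_space (density \<mu> n)" "prob_space (density \<mu> t)" "0 < a"
  shows "renyi a (density \<mu> n) (density \<mu> t) =
    (if a > 1 \<and> \<not> absolutely_continuous (density \<mu> t) (density \<mu> n) then \<infinity>
     else ereal (1 / (a * (a - 1))) *
       ln_ennreal (\<integral>\<^sup>+x. ennreal (n x powr a * t x powr (1 - a)) \<partial>\<mu>))"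
  using assms
  by (subst renyi_wrt_eq_renyi(1)[where \<mu> = \<mu>])
    (auto simp: renyi_wrt_density intro!: absolutely_continuousI_density)

section \<open>Symmetry and strict positivity of the divergence\<close>

text \<open>If \<open>a < 0\<close> or \<open>a > 1\<close>, this is the definition for negative
  orders. For \<open>0 < a < 1\<close> the absolute continuity clause is inactive on both sides, and
  both \<open>n powr a * t powr (1 - a)\<close> and \<open>a * (a - 1)\<close> are invariant under
  exchanging the measures and replacing \<open>a\<close> by \<open>1 - a\<close>.\<close>

lemma renyi_uminus_order:
  assumes "\<nu> \<in> space (prob_algebra M)" "\<theta> \<in> space (prob_algebra M)" "a \<noteq> 0" "a \<noteq> 1"
  shows "renyi (1 - a) \<theta> \<nu> = renyi a \<nu> \<theta>"
proof -
  consider "a < 0" | "1 < a" | "0 < a" "a < 1" using assms by linarith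
  then show ?thesis
  proof cases
    case 3
    obtain \<mu> and n t :: "'a \<Rightarrow> real" where *: "sigma_finite_measure \<mu>" "sets \<mu> = sets M"
      "n \<in> borel_measurable \<mu>" "t \<in> borel_measurable \<mu>" "\<And>x. 0 \<le> n x" "\<And>x. 0 \<le> t x"
      "\<nu> = density \<mu> n" "\<theta> = density \<mu> t"
      using prob_algebra_common_density[OF assms(1,2)] by blast
    moreover have "prob_space \<nu>" "prob_space \<theta>" using assms by (auto simp: space_prob_algebra)
    moreover have "(1 - a) * ((1 - a) - 1) = a * (a - 1)" by (simp add: algebra_simps)
    ultimately show ?thesis using 3 by (simp add: renyi_density mult.commute)
  qed (auto simp: renyi_def)
qed

lemma renyi_self:
  assumes P: "P \<in> space (prob_algebra M)" and a: "a \<noteq> 0" "a \<noteq> 1"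
  shows "renyi a P P = 0"
proof -
  have pos: "renyi b P P = 0" if b: "0 < b" for b
  proof -
    obtain \<mu> and n t :: "'a \<Rightarrow> real" where *: "sigma_finite_measure \<mu>"
      "n \<in> borel_measurable \<mu>" "\<And>x. 0 \<le> n x" "P = density \<mu> n"
      using prob_algebra_common_density[OF P P] by metis
    have ps: "prob_space P" using P by (simp add: space_prob_algebra)
    have "(\<integral>\<^sup>+x. ennreal (n x powr b * n x powr (1 - b)) \<partial>\<mu>) = emeasure P (space P)"
      using * by (simp add: powr_mult_powr_self emeasure_density_space)
    also have "\<dots> = 1" using ps by (rule prob_space.emeasure_space_1)
    finally show ?thesis using * b ps
      by (simp add: renyi_density ln_ennreal_def absolutely_continuous_def)
  qed
  show ?thesis
    using pos[of a] pos[of "1 - a"] renyi_uminus_order[OF P P, of a] a by (cases "0 < a") auto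
qed

text \<open>The strict mean inequalities are integrated: \<open>a * n + (1 - a) * t\<close> has
  integral 1, and the densities differ on a non-null set, so the integral of
  \<open>n powr a * t powr (1 - a)\<close> is below 1 for \<open>a < 1\<close> and above 1 for
  \<open>a > 1\<close>. The sign of \<open>1 / (a * (a - 1))\<close> makes the divergence positive
  either way.\<close>

lemma renyi_pos:
  assumes P: "P \<in> space (prob_algebra M)" and Q: "Q \<in> space (prob_algebra M)"
    and a: "a \<noteq> 0" "a \<noteq> 1" and "P \<noteq> Q"
  shows "0 < renyi a P Q"
proof -
  \<comment> \<open>Stated for arbitrary measures and positive orders, so that a negative order
    reduces to \<open>1 - a\<close> with \<open>P\<close> and \<open>Q\<close> exchanged.\<close>
  have pos: "0 < renyi a P Q"
    if P: "P \<in> space (prob_algebra M)" and Q: "Q \<in> space (prob_algebra M)"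
      and a: "0 < a" "a \<noteq> 1" and ne: "P \<noteq> Q" for a P Q
  proof -
    obtain \<mu> and n t :: "'a \<Rightarrow> real" where sf: "sigma_finite_measure \<mu>"
      and nt[measurable]: "n \<in> borel_measurable \<mu>" "t \<in> borel_measurable \<mu>"
      and nonneg: "\<And>x. 0 \<le> n x" "\<And>x. 0 \<le> t x"
      and dens: "P = density \<mu> n" "Q = density \<mu> t"
      using prob_algebra_common_density[OF P Q] by metis
    have ps: "prob_space P" "prob_space Q" using P Q by (auto simp: space_prob_algebra)
    have int_n: "(\<integral>\<^sup>+x. n x \<partial>\<mu>) = 1"
      using prob_space.emeasure_space_1[OF ps(1)] by (simp add: dens emeasure_density_space)
    have int_t: "(\<integral>\<^sup>+x. t x \<partial>\<mu>) = 1"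
      using prob_space.emeasure_space_1[OF ps(2)] by (simp add: dens emeasure_density_space)
    have int_scale: "(\<integral>\<^sup>+x. ennreal (c * n x) \<partial>\<mu>) = ennreal c"
      "(\<integral>\<^sup>+x. ennreal (c * t x) \<partial>\<mu>) = ennreal c" if "0 \<le> c" for c
      using that nonneg by (simp_all add: ennreal_mult nn_integral_cmult int_n int_t)
    have neq: "\<not> (AE x in \<mu>. n x = t x)"
    proof
      assume "AE x in \<mu>. n x = t x"
      then have "P = Q" unfolding dens by (intro density_cong) auto
      with ne show False ..
    qed
    let ?m = "\<lambda>x. n x powr a * t x powr (1 - a)"
    let ?I = "\<integral>\<^sup>+x. ennreal (?m x) \<partial>\<mu>"
    note renyi = renyi_density[OF sf nt nonneg, where a = a, folded dens]
    show ?thesis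
    proof (cases "a < 1")
      case True
      have le: "?m x \<le> a * n x + (1 - a) * t x" for x
        using powr_mult_powr_less[of a "n x" "t x"] powr_mult_powr_self[of "n x" a] True a nonneg[of x]
        by (cases "n x = t x") (auto simp: algebra_simps)
      have eq: "(\<integral>\<^sup>+x. ennreal (a * n x + (1 - a) * t x) \<partial>\<mu>) = 1"
      proof -
        have "(\<integral>\<^sup>+x. ennreal (a * n x + (1 - a) * t x) \<partial>\<mu>)
            = (\<integral>\<^sup>+x. ennreal (a * n x) + ennreal ((1 - a) * t x) \<partial>\<mu>)"
          using True a nonneg by (intro nn_integral_cong) simp
        also have "\<dots> = ennreal a + ennreal (1 - a)"
          using True a by (simp add: nn_integral_add int_scale)
        finally show ?thesis using True a by (simp flip: ennreal_plus)
      qed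
      have "?I < (\<integral>\<^sup>+x. ennreal (a * n x + (1 - a) * t x) \<partial>\<mu>)"
      proof (rule nn_integral_less)
        have "?I \<le> (\<integral>\<^sup>+x. ennreal (a * n x + (1 - a) * t x) \<partial>\<mu>)"
          by (intro nn_integral_mono ennreal_leI le)
        then show "?I \<noteq> \<infinity>" unfolding eq by (auto simp: top_unique)
        show "\<not> (AE x in \<mu>. ennreal (a * n x + (1 - a) * t x) \<le> ennreal (?m x))"
        proof
          assume "AE x in \<mu>. ennreal (a * n x + (1 - a) * t x) \<le> ennreal (?m x)"
          then have "AE x in \<mu>. n x = t x"
          proof eventually_elim
            case (elim x)
            then have "a * n x + (1 - a) * t x \<le> ?m x" by (simp add: ennreal_le_iff nonneg)
            then show ?case
              using powr_mult_powr_less[of a "n x" "t x"] True a nonneg[of x] by force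
          qed
          with neq show False ..
        qed
      qed (auto intro!: ennreal_leI le)
      then have "ln_ennreal ?I < 0" unfolding eq ln_ennreal_less_0_iff .
      moreover have "1 / (a * (a - 1)) < 0" using True a by (simp add: mult_pos_neg)
      ultimately show ?thesis
        using True a by (simp add: renyi ps ereal_zero_less_0_iff)
    next
      case False
      then have a1: "1 < a" using a by simp
      show ?thesis
      proof (cases "absolutely_continuous Q P")
        case True
        \<comment> \<open>The reversed inequality requires \<open>t > 0\<close>. Absolute continuity
          forces \<open>n = 0\<close> almost everywhere on \<open>{t = 0}\<close>, and there the two
          densities agree.\<close>
        have "{x \<in> space \<mu>. t x = 0} \<in> null_sets Q"
          unfolding dens by (subst null_sets_density_iff) auto
        then have "{x \<in> space \<mu>. t x = 0} \<in> null_sets P"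
          using True by (auto simp: absolutely_continuous_def)
        then have zero: "AE x in \<mu>. t x = 0 \<longrightarrow> n x = 0"
          unfolding dens by (subst (asm) null_sets_density_iff) (auto simp: less_le nonneg)
        \<comment> \<open>The negative term \<open>(1 - a) * t\<close> is moved to the other side,
          because \<open>ennreal\<close> would truncate negative values to 0.\<close>
        have less: "a * n x < ?m x + (a - 1) * t x" if "t x = 0 \<longrightarrow> n x = 0" "n x \<noteq> t x" for x
          using powr_mult_powr_greater[OF a1 nonneg(1), of "t x" x] that nonneg[of x]
          by (force simp: algebra_simps less_le)
        have le: "AE x in \<mu>. a * n x \<le> ?m x + (a - 1) * t x"
          using zero
        proof eventually_elim
          case (elim x)
          then show ?case
            using less[of x] powr_mult_powr_self[of "n x" a] nonneg[of x]
            by (cases "n x = t x") (auto simp: algebra_simps)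
        qed
        have "(\<integral>\<^sup>+x. ennreal (a * n x) \<partial>\<mu>) < (\<integral>\<^sup>+x. ennreal (?m x + (a - 1) * t x) \<partial>\<mu>)"
        proof (rule nn_integral_less)
          show "\<not> (AE x in \<mu>. ennreal (?m x + (a - 1) * t x) \<le> ennreal (a * n x))"
          proof
            assume "AE x in \<mu>. ennreal (?m x + (a - 1) * t x) \<le> ennreal (a * n x)"
            with zero have "AE x in \<mu>. n x = t x"
            proof eventually_elim
              case (elim x)
              then have "?m x + (a - 1) * t x \<le> a * n x"
                using a by (simp add: ennreal_le_iff nonneg)
              then show ?case using less[of x] elim(1) by force
            qed
            with neq show False ..
          qed
        qed (use le a in \<open>auto simp: int_scale elim!: eventually_mono intro!: ennreal_leI\<close>)
        also have "\<dots> = (\<integral>\<^sup>+x. ennreal (?m x) + ennreal ((a - 1) * t x) \<partial>\<mu>)"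
          using a1 nonneg by (intro nn_integral_cong) simp
        also have "\<dots> = ?I + ennreal (a - 1)"
          using a1 by (simp add: nn_integral_add int_scale)
        finally have *: "ennreal a < ?I + ennreal (a - 1)" using a by (simp add: int_scale)
        \<comment> \<open>Subtracting \<open>a - 1\<close> is done over the reals, hence the
          separate case of an infinite integral.\<close>
        have "1 < ?I"
        proof (cases ?I)
          case (real r)
          then show ?thesis using * a1
            by (simp flip: ennreal_plus ennreal_1 add: ennreal_less_iff)
        qed simp
        then have "0 < ln_ennreal ?I"
          using ln_ennreal_less_0_iff[of ?I] ln_ennreal_eq_0_iff[of ?I] by (auto simp: not_less less_le)
        then show ?thesis
          using True a1 by (simp add: renyi ps ereal_zero_less_0_iff)
      qed (use a1 in \<open>simp add: renyi ps\<close>)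
    qed
  qed
  show ?thesis
    using pos[OF P Q, of a] pos[OF Q P, of "1 - a"] renyi_uminus_order[OF P Q a] assms
    by (cases "0 < a") auto
qed

section \<open>Exponential tilting of measures\<close>

text \<open>The Gibbs measure with potential \<open>u\<close>. The Bochner integral is 0 when
  \<open>exp (u x)\<close> is not integrable, and the tilt is then the null measure; bounded
  potentials exclude this.\<close>

definition exp_tilt :: "'a measure \<Rightarrow> ('a \<Rightarrow> real) \<Rightarrow> 'a measure" where
  "exp_tilt N u = density N (\<lambda>x. ennreal (exp (u x) / (\<integral>y. exp (u y) \<partial>N)))"

lemma integrable_exp_bounded:
  fixes u :: "'a \<Rightarrow> real"
  assumes "finite_measure N" "u \<in> borel_measurable N" "bounded (u ` space N)"
  shows "integrable N (\<lambda>x. exp (u x))"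
proof -
  obtain B where "\<And>x. x \<in> space N \<Longrightarrow> \<bar>u x\<bar> \<le> B"
    using assms(3) unfolding bounded_iff by auto
  then have "\<And>x. x \<in> space N \<Longrightarrow> u x \<le> B" by (meson abs_le_D1)
  then show ?thesis using assms
    by (intro finite_measure.integrable_const_bound[where B = "exp B"]) auto
qed

lemma integral_exp_pos:
  fixes u :: "'a \<Rightarrow> real"
  assumes "prob_space N" "u \<in> borel_measurable N" "bounded (u ` space N)"
  shows "0 < (\<integral>x. exp (u x) \<partial>N)"
proof -
  interpret prob_space N by fact
  have "integrable N (\<lambda>x. exp (u x))"
    using assms finite_measure_axioms by (intro integrable_exp_bounded)
  then show ?thesis
    using integral_less_AE_space[of "\<lambda>_. 0" "\<lambda>x. exp (u x)"] by (simp add: emeasure_space_1)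
qed

lemma exp_tilt_in_prob_algebra:
  assumes N: "N \<in> space (prob_algebra M)" and u: "u \<in> borel_measurable M" "bounded (u ` space M)"
  shows "exp_tilt N u \<in> space (prob_algebra M)"
proof -
  have s: "sets N = sets M" and ps: "prob_space N" using N by (auto simp: space_prob_algebra)
  have sp: "space N = space M" using s by (rule sets_eq_imp_space_eq)
  have [measurable]: "u \<in> borel_measurable N" using u s by (simp cong: measurable_cong_sets)
  have b: "bounded (u ` space N)" using u sp by simp
  note int = integrable_exp_bounded[OF prob_space.finite_measure[OF ps] \<open>u \<in> borel_measurable N\<close> b]
  note pos = integral_exp_pos[OF ps \<open>u \<in> borel_measurable N\<close> b]
  have "(\<integral>\<^sup>+x. ennreal (exp (u x) / (\<integral>y. exp (u y) \<partial>N)) \<partial>N) = 1"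
    using int pos by (subst nn_integral_eq_integral) auto
  then have "prob_space (exp_tilt N u)"
    by (intro prob_spaceI) (simp add: exp_tilt_def emeasure_density_space)
  then show ?thesis using s by (simp add: space_prob_algebra exp_tilt_def)
qed

text \<open>Potentials add: the normalizer of the second tilt is that of the combined tilt divided
  by \<open>Z\<close>, so \<open>Z\<close> cancels.\<close>

lemma exp_tilt_exp_tilt:
  assumes N: "N \<in> space (prob_algebra M)"
    and u: "u \<in> borel_measurable M" "bounded (u ` space M)" and v: "v \<in> borel_measurable M"
  shows "exp_tilt (exp_tilt N u) v = exp_tilt N (\<lambda>x. u x + v x)"
proof -
  have s: "sets N = sets M" and ps: "prob_space N" using N by (auto simp: space_prob_algebra)
  have sp: "space N = space M" using s by (rule sets_eq_imp_space_eq)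
  have [measurable]: "u \<in> borel_measurable N" "v \<in> borel_measurable N"
    using u v s by (simp_all cong: measurable_cong_sets)
  define Z where "Z = (\<integral>x. exp (u x) \<partial>N)"
  have Z: "0 < Z" unfolding Z_def using u sp by (intro integral_exp_pos[OF ps]) simp_all
  have W: "(\<integral>x. exp (v x) \<partial>exp_tilt N u) = (\<integral>x. exp (u x + v x) \<partial>N) / Z"
    unfolding exp_tilt_def Z_def[symmetric] using Z
    by (subst integral_density) (auto simp: exp_add)
  show ?thesis
    unfolding exp_tilt_def[of "exp_tilt N u"] W
    unfolding exp_tilt_def Z_def[symmetric] using Z
    by (subst density_density_eq)
      (auto simp: exp_add simp flip: ennreal_mult' intro!: density_cong)
qed

lemma exp_tilt_zero:
  assumes "prob_space N"
  shows "exp_tilt N (\<lambda>x. 0) = N"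
proof -
  interpret prob_space N by fact
  show ?thesis by (simp add: exp_tilt_def prob_space density_1)
qed

text \<open>The tilting density is strictly positive, so tilting preserves null sets.\<close>

lemma absolutely_continuous_exp_tilt_iff:
  assumes N: "N \<in> space (prob_algebra M)" and N': "N' \<in> space (prob_algebra M)"
    and u: "u \<in> borel_measurable M" "bounded (u ` space M)"
    and v: "v \<in> borel_measurable M" "bounded (v ` space M)"
  shows "absolutely_continuous (exp_tilt N' v) (exp_tilt N u) \<longleftrightarrow> absolutely_continuous N' N"
proof -
  have null: "null_sets (exp_tilt K w) = null_sets K"
    if K: "K \<in> space (prob_algebra M)" and w: "w \<in> borel_measurable M" "bounded (w ` space M)" for K w
  proof -
    have s: "sets K = sets M" and ps: "prob_space K" using K by (auto simp: space_prob_algebra)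
    have sp: "space K = space M" using s by (rule sets_eq_imp_space_eq)
    have [measurable]: "w \<in> borel_measurable K" using w s by (simp cong: measurable_cong_sets)
    have "0 < (\<integral>x. exp (w x) \<partial>K)" using w sp by (intro integral_exp_pos[OF ps]) simp_all
    then show ?thesis
      unfolding exp_tilt_def
      by (auto simp: null_sets_density_iff AE_iff_null_sets sets.sets_into_space
          eventually_ae_filter)
  qed
  show ?thesis unfolding absolutely_continuous_def using assms by (simp add: null)
qed


section \<open>The divergence between tilted measures\<close>

text \<open>By \<open>balance\<close>, the factors \<open>exp (u x) powr a\<close> and
  \<open>exp (v x) powr (1 - a)\<close> multiply to 1. Only the normalizers survive, as a constant
  factor of the integral, which the logarithm turns into a finite additive term.\<close>

lemma renyi_exp_tilt:
  assumes \<nu>: "\<nu> \<in> space (prob_algebra M)" and \<theta>: "\<theta> \<in> space (prob_algebra M)"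
    and u: "u \<in> borel_measurable M" "bounded (u ` space M)"
    and v: "v \<in> borel_measurable M" "bounded (v ` space M)"
    and a: "a \<noteq> 0" "a \<noteq> 1" and balance: "\<And>x. a * u x + (1 - a) * v x = 0"
  shows "renyi a (exp_tilt \<nu> u) (exp_tilt \<theta> v) =
    renyi a \<nu> \<theta> + ereal (ln (\<integral>x. exp (v x) \<partial>\<theta>) / a - ln (\<integral>x. exp (u x) \<partial>\<nu>) / (a - 1))"
proof -
  have pos: "renyi a (exp_tilt \<nu> u) (exp_tilt \<theta> v) =
      renyi a \<nu> \<theta> + ereal (ln (\<integral>x. exp (v x) \<partial>\<theta>) / a - ln (\<integral>x. exp (u x) \<partial>\<nu>) / (a - 1))"
    if \<nu>: "\<nu> \<in> space (prob_algebra M)" and \<theta>: "\<theta> \<in> space (prob_algebra M)"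
      and u: "u \<in> borel_measurable M" "bounded (u ` space M)"
      and v: "v \<in> borel_measurable M" "bounded (v ` space M)"
      and a: "0 < a" "a \<noteq> 1" and balance: "\<And>x. a * u x + (1 - a) * v x = 0"
    for a \<nu> \<theta> u v
  proof -
    obtain \<mu> and n t :: "'a \<Rightarrow> real" where sf: "sigma_finite_measure \<mu>" and s\<mu>: "sets \<mu> = sets M"
      and [measurable]: "n \<in> borel_measurable \<mu>" "t \<in> borel_measurable \<mu>"
      and nonneg: "\<And>x. 0 \<le> n x" "\<And>x. 0 \<le> t x"
      and dens: "\<nu> = density \<mu> n" "\<theta> = density \<mu> t"
      using prob_algebra_common_density[OF \<nu> \<theta>] by metis
    have sp: "space \<mu> = space M" using s\<mu> by (rule sets_eq_imp_space_eq)
    have [measurable]: "u \<in> borel_measurable \<mu>" "v \<in> borel_measurable \<mu>"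
      using u v s\<mu> by (simp_all cong: measurable_cong_sets)
    have ps: "prob_space \<nu>" "prob_space \<theta>" "prob_space (exp_tilt \<nu> u)" "prob_space (exp_tilt \<theta> v)"
      using \<nu> \<theta> exp_tilt_in_prob_algebra[OF \<nu> u] exp_tilt_in_prob_algebra[OF \<theta> v]
      by (auto simp: space_prob_algebra)
    define A where "A = (\<integral>x. exp (u x) \<partial>\<nu>)"
    define B where "B = (\<integral>x. exp (v x) \<partial>\<theta>)"
    have A: "0 < A" unfolding A_def
      using u(2) sp by (intro integral_exp_pos[OF ps(1)]) (simp_all add: dens)
    have B: "0 < B" unfolding B_def
      using v(2) sp by (intro integral_exp_pos[OF ps(2)]) (simp_all add: dens)
    have tilt: "exp_tilt \<nu> u = density \<mu> (\<lambda>x. ennreal (n x * (exp (u x) / A)))"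
      "exp_tilt \<theta> v = density \<mu> (\<lambda>x. ennreal (t x * (exp (v x) / B)))"
      unfolding exp_tilt_def A_def[symmetric] B_def[symmetric]
      unfolding dens using A B nonneg
      by (simp_all add: density_density_eq flip: ennreal_mult)
    \<comment> \<open>The normalizers \<open>A\<close> and \<open>B\<close> contribute
      \<open>A powr (- a)\<close> and \<open>B powr (- (1 - a))\<close>.\<close>
    define C where "C = A powr (- a) * B powr (a - 1)"
    have C: "0 < C" and ln_C: "ln C = (a - 1) * ln B - a * ln A"
      using A B by (simp_all add: C_def ln_mult ln_powr)
    let ?I = "\<integral>\<^sup>+x. ennreal (n x powr a * t x powr (1 - a)) \<partial>\<mu>"
    have "(\<integral>\<^sup>+x. ennreal ((n x * (exp (u x) / A)) powr a * (t x * (exp (v x) / B)) powr (1 - a)) \<partial>\<mu>)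
        = (\<integral>\<^sup>+x. ennreal C * ennreal (n x powr a * t x powr (1 - a)) \<partial>\<mu>)"
    proof (rule nn_integral_cong)
      fix x
      have "exp (u x) powr a * exp (v x) powr (1 - a) = exp (a * u x + (1 - a) * v x)"
        by (simp add: exp_powr_real exp_add mult.commute)
      then have e: "exp (u x) powr a * exp (v x) powr (1 - a) = 1" by (simp add: balance)
      have "(n x * (exp (u x) / A)) powr a * (t x * (exp (v x) / B)) powr (1 - a)
          = (n x powr a * (exp (u x) powr a / A powr a)) *
            (t x powr (1 - a) * (exp (v x) powr (1 - a) / B powr (1 - a)))"
        using A B nonneg by (simp add: powr_mult powr_divide del: exp_powr_real)
      also have "\<dots> = (exp (u x) powr a * exp (v x) powr (1 - a)) *
          (n x powr a * t x powr (1 - a)) * (inverse (A powr a) * inverse (B powr (1 - a)))"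
        by (simp add: divide_inverse mult_ac)
      also have "inverse (A powr a) * inverse (B powr (1 - a)) = C"
        by (simp add: C_def powr_minus[symmetric])
      finally have "(n x * (exp (u x) / A)) powr a * (t x * (exp (v x) / B)) powr (1 - a)
          = C * (n x powr a * t x powr (1 - a))" by (simp add: e mult_ac)
      then show "ennreal ((n x * (exp (u x) / A)) powr a * (t x * (exp (v x) / B)) powr (1 - a))
          = ennreal C * ennreal (n x powr a * t x powr (1 - a))"
        using C by (simp add: ennreal_mult)
    qed
    also have "\<dots> = ennreal C * ?I" by (rule nn_integral_cmult) measurable
    finally have I: "(\<integral>\<^sup>+x. ennreal ((n x * (exp (u x) / A)) powr a *
      (t x * (exp (v x) / B)) powr (1 - a)) \<partial>\<mu>) = ennreal C * ?I" .
    have const: "1 / (a * (a - 1)) * ln C = ln B / a - ln A / (a - 1)"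
      using a by (simp add: ln_C field_simps)
    have ac: "absolutely_continuous (exp_tilt \<theta> v) (exp_tilt \<nu> u) \<longleftrightarrow> absolutely_continuous \<theta> \<nu>"
      by (rule absolutely_continuous_exp_tilt_iff[OF \<nu> \<theta> u v])
    have L: "renyi a (exp_tilt \<nu> u) (exp_tilt \<theta> v) =
      (if a > 1 \<and> \<not> absolutely_continuous \<theta> \<nu> then \<infinity>
       else ereal (1 / (a * (a - 1))) * ln_ennreal (ennreal C * ?I))"
      unfolding ac[symmetric] I[symmetric] unfolding tilt
      using sf ps(3,4) nonneg A B a by (intro renyi_density) (auto simp: tilt)
    have R: "renyi a \<nu> \<theta> =
      (if a > 1 \<and> \<not> absolutely_continuous \<theta> \<nu> then \<infinity>
       else ereal (1 / (a * (a - 1))) * ln_ennreal ?I)"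
      unfolding dens using sf ps(1,2) nonneg a by (intro renyi_density) (auto simp: dens)
    \<comment> \<open>Distributivity can fail for extended reals; it holds here because the factor
      and \<open>ln C\<close> are finite, whatever \<open>y\<close> is.\<close>
    have "ereal (1 / (a * (a - 1))) * (ereal (ln C) + y) =
        ereal (1 / (a * (a - 1))) * y + ereal (1 / (a * (a - 1)) * ln C)" for y
      by (cases y) (auto simp: add_divide_distrib)
    then show ?thesis unfolding L R A_def[symmetric] B_def[symmetric] const[symmetric]
      by (simp add: ln_ennreal_mult[OF C])
  qed
  show ?thesis
  proof (cases "0 < a")
    case True
    then show ?thesis using assms by (intro pos)
  next
    case False
    then have "0 < 1 - a" "1 - a \<noteq> 1" using a by auto
    \<comment> \<open>The balance condition is invariant under exchanging \<open>u\<close> with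
      \<open>v\<close> and \<open>a\<close> with \<open>1 - a\<close>, so the positive case applies
      to the exchanged measures.\<close>
    moreover have "(1 - a) * v x + (1 - (1 - a)) * u x = 0" for x using balance[of x] by simp
    ultimately have "renyi (1 - a) (exp_tilt \<theta> v) (exp_tilt \<nu> u) = renyi (1 - a) \<theta> \<nu> +
        ereal (ln (\<integral>x. exp (u x) \<partial>\<nu>) / (1 - a) - ln (\<integral>x. exp (v x) \<partial>\<theta>) / ((1 - a) - 1))"
      by (intro pos \<nu> \<theta> u v)
    moreover have "ln (\<integral>x. exp (u x) \<partial>\<nu>) / (1 - a) - ln (\<integral>x. exp (v x) \<partial>\<theta>) / ((1 - a) - 1)
        = ln (\<integral>x. exp (v x) \<partial>\<theta>) / a - ln (\<integral>x. exp (u x) \<partial>\<nu>) / (a - 1)"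
      using a by (simp add: field_simps)
    ultimately show ?thesis
      by (simp add: renyi_uminus_order[OF \<nu> \<theta> a]
        renyi_uminus_order[OF exp_tilt_in_prob_algebra[OF \<nu> u] exp_tilt_in_prob_algebra[OF \<theta> v] a])
  qed
qed

section \<open>The variational inequalities and their equality cases\<close>

lemma bounded_cmult_image:
  fixes g :: "'a \<Rightarrow> real"
  assumes "bounded (g ` S)"
  shows "bounded ((\<lambda>x. c * g x) ` S)"
  using bounded_scaling[OF assms, of c] by (simp add: image_image)

text \<open>Tilting by multiples of \<open>g\<close> is an action of the additive group of the
  reals, so the tilt by \<open>c * g\<close> is undone by the tilt by \<open>- c * g\<close>. This
  turns \<open>P = Q\<close> into an explicit formula for the optimizer.\<close>

lemma exp_tilt_eq_exp_tilt_iff: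
  assumes \<nu>: "\<nu> \<in> space (prob_algebra M)" and \<theta>: "\<theta> \<in> space (prob_algebra M)"
    and g: "g \<in> borel_measurable M" "bounded (g ` space M)"
  shows "exp_tilt \<nu> (\<lambda>x. b * g x) = exp_tilt \<theta> (\<lambda>x. c * g x) \<longleftrightarrow>
    \<theta> = exp_tilt \<nu> (\<lambda>x. (b - c) * g x)"
proof -
  have comp: "exp_tilt (exp_tilt \<kappa> (\<lambda>x. p * g x)) (\<lambda>x. q * g x) = exp_tilt \<kappa> (\<lambda>x. (p + q) * g x)"
    if "\<kappa> \<in> space (prob_algebra M)" for \<kappa> p q
    using that g by (subst exp_tilt_exp_tilt) (auto simp: bounded_cmult_image distrib_right)
  have "prob_space \<theta>" using \<theta> by (simp add: space_prob_algebra)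
  then have "exp_tilt (exp_tilt \<theta> (\<lambda>x. c * g x)) (\<lambda>x. (- c) * g x) = \<theta>"
    unfolding comp[OF \<theta>] by (simp add: exp_tilt_zero)
  moreover have "exp_tilt (exp_tilt \<nu> (\<lambda>x. b * g x)) (\<lambda>x. (- c) * g x) = exp_tilt \<nu> (\<lambda>x. (b - c) * g x)"
    unfolding comp[OF \<nu>] by simp
  moreover have "exp_tilt (exp_tilt \<nu> (\<lambda>x. (b - c) * g x)) (\<lambda>x. c * g x) = exp_tilt \<nu> (\<lambda>x. b * g x)"
    unfolding comp[OF \<nu>] by simp
  ultimately show ?thesis by metis
qed

lemma renyi_variational_minimum:
  assumes "\<beta> \<noteq> 0" "\<gamma> \<noteq> 0" "\<beta> < \<gamma>"
    and \<nu>: "\<nu> \<in> space (prob_algebra M)" and \<theta>: "\<theta> \<in> space (prob_algebra M)"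
    and g: "g \<in> borel_measurable M" "bounded (g ` space M)"
  defines "L \<equiv> ereal (1 / \<beta> * ln (\<integral>x. exp (\<beta> * g x) \<partial>\<nu>))"
    and "F \<equiv> ereal (1 / \<gamma> * ln (\<integral>x. exp (\<gamma> * g x) \<partial>\<theta>))
      + ereal (1 / (\<gamma> - \<beta>)) * renyi (\<gamma> / (\<gamma> - \<beta>)) \<nu> \<theta>"
  shows "L \<le> F" and "F = L \<longleftrightarrow> \<theta> = exp_tilt \<nu> (\<lambda>x. - (\<gamma> - \<beta>) * g x)"
proof -
  define d where "d = \<gamma> - \<beta>"
  define a where "a = \<gamma> / d"
  have d: "0 < d" using assms by (simp add: d_def)
  \<comment> \<open>\<open>\<gamma> \<noteq> 0\<close> excludes the order 0 and
    \<open>\<beta> \<noteq> 0\<close> excludes the order 1, because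
    \<open>a - 1 = \<beta> / d\<close>.\<close>
  have a: "a \<noteq> 0" "a \<noteq> 1" using assms d by (auto simp: a_def d_def)
  have a': "a - 1 = \<beta> / d" using d by (simp add: a_def field_simps) (simp add: d_def)
  define P where "P = exp_tilt \<nu> (\<lambda>x. \<beta> * g x)"
  define Q where "Q = exp_tilt \<theta> (\<lambda>x. \<gamma> * g x)"
  have P: "P \<in> space (prob_algebra M)" and Q: "Q \<in> space (prob_algebra M)"
    using g by (auto simp: P_def Q_def intro!: exp_tilt_in_prob_algebra \<nu> \<theta> bounded_cmult_image)
  define x y where "x = ln (\<integral>x. exp (\<beta> * g x) \<partial>\<nu>)" and "y = ln (\<integral>x. exp (\<gamma> * g x) \<partial>\<theta>)"
  have "a * (\<beta> * g z) + (1 - a) * (\<gamma> * g z) = 0" for z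
  proof -
    have "1 - a = - (\<beta> / d)" using a' by linarith
    then show ?thesis by (simp add: a_def)
  qed
  then have "renyi a P Q = renyi a \<nu> \<theta> + ereal (y / a - x / (a - 1))"
    unfolding P_def Q_def x_def y_def using g a
    by (intro renyi_exp_tilt) (auto intro!: \<nu> \<theta> bounded_cmult_image)
  \<comment> \<open>After division by \<open>d\<close> this correction is exactly the difference of
    the two logarithmic terms in \<open>F\<close> and \<open>L\<close>.\<close>
  also have "y / a - x / (a - 1) = d * (y / \<gamma> - x / \<beta>)"
    unfolding a' by (simp add: a_def algebra_simps)
  finally have eq: "F = L + ereal (1 / d) * renyi a P Q"
    unfolding F_def L_def d_def[symmetric] a_def[symmetric] x_def[symmetric] y_def[symmetric]
    using d by (cases "renyi a \<nu> \<theta>") (auto simp: field_simps)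
  have R: "0 \<le> renyi a P Q" "renyi a P Q = 0 \<longleftrightarrow> P = Q"
    using renyi_pos[OF P Q a] renyi_self[OF P a] by (cases "P = Q"; force)+
  then show "L \<le> F"
    unfolding eq using d by (simp add: L_def ereal_le_add_self)
  \<comment> \<open>\<open>L\<close> is finite, so it cancels even if the divergence is
    infinite.\<close>
  have "F = L \<longleftrightarrow> renyi a P Q = 0"
    unfolding eq L_def using d by (cases "renyi a P Q") auto
  also have "\<dots> \<longleftrightarrow> \<theta> = exp_tilt \<nu> (\<lambda>x. (\<beta> - \<gamma>) * g x)"
    unfolding R(2) unfolding P_def Q_def by (rule exp_tilt_eq_exp_tilt_iff[OF \<nu> \<theta> g])
  finally show "F = L \<longleftrightarrow> \<theta> = exp_tilt \<nu> (\<lambda>x. - (\<gamma> - \<beta>) * g x)" by simp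
qed

lemma renyi_variational_maximum:
  assumes "\<beta> \<noteq> 0" "\<gamma> \<noteq> 0" "\<beta> < \<gamma>"
    and \<nu>: "\<nu> \<in> space (prob_algebra M)" and \<theta>: "\<theta> \<in> space (prob_algebra M)"
    and g: "g \<in> borel_measurable M" "bounded (g ` space M)"
  defines "L \<equiv> ereal (1 / \<gamma> * ln (\<integral>x. exp (\<gamma> * g x) \<partial>\<nu>))"
    and "G \<equiv> ereal (1 / \<beta> * ln (\<integral>x. exp (\<beta> * g x) \<partial>\<theta>))
      - ereal (1 / (\<gamma> - \<beta>)) * renyi (\<gamma> / (\<gamma> - \<beta>)) \<theta> \<nu>"
  shows "G \<le> L" and "G = L \<longleftrightarrow> \<theta> = exp_tilt \<nu> (\<lambda>x. (\<gamma> - \<beta>) * g x)"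
proof -
  define a where "a = \<gamma> / (\<gamma> - \<beta>)"
  \<comment> \<open>The order belonging to the pair \<open>(- \<gamma>, - \<beta>)\<close> is
    \<open>1 - a\<close>; the symmetry of the divergence returns it to \<open>a\<close> with the
    measures exchanged.\<close>
  have a: "a \<noteq> 0" "a \<noteq> 1" "1 - a = - \<beta> / (- \<beta> - - \<gamma>)" using assms by (auto simp: a_def field_simps)
  have g': "(\<lambda>x. - g x) \<in> borel_measurable M" "bounded ((\<lambda>x. - g x) ` space M)"
    using g bounded_cmult_image[OF g(2), of "-1"] by auto
  note * = renyi_variational_minimum[of "- \<gamma>" "- \<beta>", OF _ _ _ \<nu> \<theta> g',
      folded a(3), unfolded renyi_uminus_order[OF \<theta> \<nu> a(1,2)]]
  let ?F = "ereal (1 / (- \<beta>) * ln (\<integral>x. exp (- \<beta> * - g x) \<partial>\<theta>))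
      + ereal (1 / (- \<beta> - - \<gamma>)) * renyi a \<theta> \<nu>"
  have G: "G = - ?F" unfolding G_def a_def[symmetric] using assms(3)
    by (cases "renyi a \<theta> \<nu>") auto
  have L: "L = - ereal (1 / (- \<gamma>) * ln (\<integral>x. exp (- \<gamma> * - g x) \<partial>\<nu>))" by (simp add: L_def)
  show "G \<le> L" unfolding G L ereal_minus_le_minus using assms by (intro *) auto
  have "G = L \<longleftrightarrow> \<theta> = exp_tilt \<nu> (\<lambda>x. - (- \<beta> - - \<gamma>) * - g x)"
    unfolding G L ereal_uminus_eq_iff using assms by (intro *) auto
  then show "G = L \<longleftrightarrow> \<theta> = exp_tilt \<nu> (\<lambda>x. (\<gamma> - \<beta>) * g x)" by (simp add: algebra_simps)
qed

text \<open>A lower bound that is met exactly at one point is the infimum, so the equality case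
  yields both attainment and uniqueness.\<close>

lemma INF_unique_minimizer:
  fixes F :: "'b \<Rightarrow> ereal"
  assumes "\<And>\<theta>. \<theta> \<in> X \<Longrightarrow> L \<le> F \<theta>" "\<And>\<theta>. \<theta> \<in> X \<Longrightarrow> F \<theta> = L \<longleftrightarrow> \<theta> = \<theta>0" "\<theta>0 \<in> X"
  shows "L = (INF \<theta>\<in>X. F \<theta>) \<and> \<theta>0 \<in> X \<and> (\<forall>\<theta>\<in>X. F \<theta> = (INF \<theta>'\<in>X. F \<theta>') \<longleftrightarrow> \<theta> = \<theta>0)"
proof -
  have "L = (INF \<theta>\<in>X. F \<theta>)"
  proof (rule antisym)
    show "L \<le> (INF \<theta>\<in>X. F \<theta>)" using assms(1) by (rule INF_greatest)
    show "(INF \<theta>\<in>X. F \<theta>) \<le> L" using assms(2,3) by (metis INF_lower)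
  qed
  then show ?thesis using assms(2,3) by metis
qed

lemma SUP_unique_maximizer:
  fixes F :: "'b \<Rightarrow> ereal"
  assumes "\<And>\<theta>. \<theta> \<in> X \<Longrightarrow> F \<theta> \<le> L" "\<And>\<theta>. \<theta> \<in> X \<Longrightarrow> F \<theta> = L \<longleftrightarrow> \<theta> = \<theta>0" "\<theta>0 \<in> X"
  shows "L = (SUP \<theta>\<in>X. F \<theta>) \<and> \<theta>0 \<in> X \<and> (\<forall>\<theta>\<in>X. F \<theta> = (SUP \<theta>'\<in>X. F \<theta>') \<longleftrightarrow> \<theta> = \<theta>0)"
proof -
  have "L = (SUP \<theta>\<in>X. F \<theta>)"
  proof (rule antisym)
    show "(SUP \<theta>\<in>X. F \<theta>) \<le> L" using assms(1) by (rule SUP_least)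
    show "L \<le> (SUP \<theta>\<in>X. F \<theta>)" using assms(2,3) by (metis SUP_upper)
  qed
  then show ?thesis using assms(2,3) by metis
qed

theorem theorem2p1:
  fixes M \<nu> :: "'a measure" and \<beta> \<gamma> :: real and g :: "'a \<Rightarrow> real"
  assumes "\<beta> \<noteq> 0" "\<gamma> \<noteq> 0" "\<beta> < \<gamma>"
    and "\<nu> \<in> space (prob_algebra M)"
    and "g \<in> borel_measurable M" "bounded (g ` space M)"
  shows
    "(let F = (\<lambda>\<theta>. ereal (1 / \<gamma> * ln (\<integral>x. exp (\<gamma> * g x) \<partial>\<theta>))
                 + ereal (1 / (\<gamma> - \<beta>)) * renyi (\<gamma> / (\<gamma> - \<beta>)) \<nu> \<theta>);
          Z = (\<integral>x. exp (- (\<gamma> - \<beta>) * g x) \<partial>\<nu>);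
          \<theta>0 = density \<nu> (\<lambda>x. ennreal (1 / Z * exp (- (\<gamma> - \<beta>) * g x)))
      in ereal (1 / \<beta> * ln (\<integral>x. exp (\<beta> * g x) \<partial>\<nu>)) = (INF \<theta>\<in>space (prob_algebra M). F \<theta>)
         \<and> \<theta>0 \<in> space (prob_algebra M)
         \<and> (\<forall>\<theta>\<in>space (prob_algebra M).
              F \<theta> = (INF \<theta>'\<in>space (prob_algebra M). F \<theta>') \<longleftrightarrow> \<theta> = \<theta>0))
     \<and>
     (let G = (\<lambda>\<theta>. ereal (1 / \<beta> * ln (\<integral>x. exp (\<beta> * g x) \<partial>\<theta>))
                 - ereal (1 / (\<gamma> - \<beta>)) * renyi (\<gamma> / (\<gamma> - \<beta>)) \<theta> \<nu>);
          Z = (\<integral>x. exp ((\<gamma> - \<beta>) * g x) \<partial>\<nu>);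
          \<theta>0 = density \<nu> (\<lambda>x. ennreal (1 / Z * exp ((\<gamma> - \<beta>) * g x)))
      in ereal (1 / \<gamma> * ln (\<integral>x. exp (\<gamma> * g x) \<partial>\<nu>)) = (SUP \<theta>\<in>space (prob_algebra M). G \<theta>)
         \<and> \<theta>0 \<in> space (prob_algebra M)
         \<and> (\<forall>\<theta>\<in>space (prob_algebra M).
              G \<theta> = (SUP \<theta>'\<in>space (prob_algebra M). G \<theta>') \<longleftrightarrow> \<theta> = \<theta>0))"
proof -
  \<comment> \<open>Both optimizers in the statement are tilts of \<open>\<nu>\<close>, with
    \<open>c = - (\<gamma> - \<beta>)\<close> and \<open>c = \<gamma> - \<beta>\<close>.\<close>
  have tilt: "density \<nu> (\<lambda>x. ennreal (1 / (\<integral>x. exp (c * g x) \<partial>\<nu>) * exp (c * g x)))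
      = exp_tilt \<nu> (\<lambda>x. c * g x)" for c
    by (simp add: exp_tilt_def)
  have mem: "exp_tilt \<nu> (\<lambda>x. c * g x) \<in> space (prob_algebra M)" for c
    using assms(4-6) by (intro exp_tilt_in_prob_algebra bounded_cmult_image) auto
  note min = renyi_variational_minimum[OF assms(1-4) _ assms(5,6)]
  note max = renyi_variational_maximum[OF assms(1-4) _ assms(5,6)]
  show ?thesis
    unfolding Let_def tilt
    by (intro conjI[OF INF_unique_minimizer SUP_unique_maximizer] min max mem)
qed

end
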